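(* Let $p\ge 6$ and let $\Sigma\in\mathbb{R}^{p\times p}$ be positive definite. Then $\Sigma\in F_{p,2}\setminus F_{p,1}$ if and only if every $6\times 6$ principal submatrix of $\Sigma$ belongs to $F_{6,2}$ and at least one $4\times 4$ principal submatrix of $\Sigma$ does not belong to $F_{4,1}$.
   Context: For integers $p\ge 1$, $m\ge 1$, $F_{p,m}=\{\Delta+\Gamma\Gamma^t : \Delta \text{ a positive definite diagonal } p\times p \text{ matrix},\ \Gamma\in\mathbb{R}^{p\times m}\}$. *)

theory Defs
  imports "Jordan_Normal_Form.Matrix" "Jordan_Normal_Form.DL_Submatrix"
begin

definition pos_def_mat :: "nat \<Rightarrow> real mat \<Rightarrow> bool" where
  "pos_def_mat p A \<longleftrightarrow> A \<in> carrier_mat p p \<and> A\<^sup>T = A \<and>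
     (\<forall>x \<in> carrier_vec p. x \<noteq> 0\<^sub>v p \<longrightarrow> x \<bullet> (A *\<^sub>v x) > 0)"

definition F_model :: "nat \<Rightarrow> nat \<Rightarrow> real mat set" where
  "F_model p m = {D + G * G\<^sup>T | D G. D \<in> carrier_mat p p \<and> diagonal_mat D \<and>
       (\<forall>i<p. D $$ (i,i) > 0) \<and> G \<in> carrier_mat p m}"

end

theory Submission
  imports Defs
begin

text \<open>
  Membership in the model asks for vectors \<open>g\<^sub>i \<in> \<real>\<^sup>m\<close> with \<open>\<langle>g\<^sub>i, g\<^sub>j\<rangle> = \<sigma>\<^sub>i\<^sub>j\<close> off the diagonal
  and \<open>|g\<^sub>i|\<^sup>2 < \<sigma>\<^sub>i\<^sub>i\<close>. Both \<open>F\<^sub>p\<^sub>,\<^sub>1\<close> and \<open>F\<^sub>p\<^sub>,\<^sub>2\<close> are determined locally, by the principal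
  submatrices of size 4 and 6.

  For two factors, suppose first that a tetrad \<open>\<sigma>\<^sub>a\<^sub>c \<sigma>\<^sub>b\<^sub>d - \<sigma>\<^sub>a\<^sub>d \<sigma>\<^sub>b\<^sub>c\<close> is nonzero. Then in every
  representation \<open>g\<^sub>k\<close> is a combination of \<open>g\<^sub>c\<close> and \<open>g\<^sub>d\<close> whose coefficients depend only on the
  covariances, and one further index with a nonzero coefficient at \<open>g\<^sub>c\<close> (at \<open>g\<^sub>d\<close>) determines
  \<open>|g\<^sub>c|\<^sup>2\<close> (\<open>|g\<^sub>d|\<^sup>2\<close>). Hence the representation of a 6-set that contains \<open>a, b, c, d\<close> and two such
  indices extends to all indices.

  If all tetrads vanish, then either at most three indices have a nonzero covariance with another
  index, or the off-diagonal part has rank one, and four vectors in the plane force the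
  strict diagonal inequalities of the one-factor model.
\<close>

section \<open>Vector representations over an index set\<close>

text \<open>The model is restated for a set of indices and a covariance function, so that taking a
  principal submatrix becomes restricting to a subset. The diagonal summand is absorbed into the
  strict inequalities.\<close>

definition factor_on :: "'a set \<Rightarrow> nat \<Rightarrow> ('a \<Rightarrow> 'a \<Rightarrow> real) \<Rightarrow> bool" where
  "factor_on A m s \<longleftrightarrow> (\<exists>g :: 'a \<Rightarrow> nat \<Rightarrow> real.
     (\<forall>i\<in>A. (\<Sum>k<m. g i k * g i k) < s i i) \<and>
     (\<forall>i\<in>A. \<forall>j\<in>A. i \<noteq> j \<longrightarrow> s i j = (\<Sum>k<m. g i k * g j k)))"

lemma factor_on_1:
  "factor_on A 1 s \<longleftrightarrow> (\<exists>u. (\<forall>i\<in>A. u i * u i < s i i) \<and>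
     (\<forall>i\<in>A. \<forall>j\<in>A. i \<noteq> j \<longrightarrow> s i j = u i * u j))"
proof
  assume "factor_on A 1 s"
  then show "\<exists>u. (\<forall>i\<in>A. u i * u i < s i i) \<and> (\<forall>i\<in>A. \<forall>j\<in>A. i \<noteq> j \<longrightarrow> s i j = u i * u j)"
    unfolding factor_on_def by auto
next
  assume "\<exists>u. (\<forall>i\<in>A. u i * u i < s i i) \<and> (\<forall>i\<in>A. \<forall>j\<in>A. i \<noteq> j \<longrightarrow> s i j = u i * u j)"
  then obtain u where "\<forall>i\<in>A. u i * u i < s i i" "\<forall>i\<in>A. \<forall>j\<in>A. i \<noteq> j \<longrightarrow> s i j = u i * u j"
    by blast
  then show "factor_on A 1 s"
    unfolding factor_on_def by (intro exI[of _ "\<lambda>i k. u i"]) auto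
qed

lemma factor_on_2:
  "factor_on A 2 s \<longleftrightarrow> (\<exists>u v. (\<forall>i\<in>A. u i * u i + v i * v i < s i i) \<and>
     (\<forall>i\<in>A. \<forall>j\<in>A. i \<noteq> j \<longrightarrow> s i j = u i * u j + v i * v j))"
    (is "_ \<longleftrightarrow> (\<exists>u v. ?P u v)")
proof
  assume "factor_on A 2 s"
  then obtain g :: "'a \<Rightarrow> nat \<Rightarrow> real"
    where "\<forall>i\<in>A. (\<Sum>k<2. g i k * g i k) < s i i"
      "\<forall>i\<in>A. \<forall>j\<in>A. i \<noteq> j \<longrightarrow> s i j = (\<Sum>k<2. g i k * g j k)"
    unfolding factor_on_def by blast
  then show "\<exists>u v. ?P u v"
    by (intro exI[of _ "\<lambda>i. g i 0"] exI[of _ "\<lambda>i. g i 1"]) (simp add: numeral_2_eq_2)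
next
  assume "\<exists>u v. ?P u v"
  then obtain u v where "?P u v" by blast
  then show "factor_on A 2 s"
    unfolding factor_on_def
    by (intro exI[of _ "\<lambda>i k. if k = 0 then u i else v i"]) (simp add: numeral_2_eq_2)
qed

lemma factor_on_subset: "factor_on B m s \<Longrightarrow> A \<subseteq> B \<Longrightarrow> factor_on A m s"
  unfolding factor_on_def by (meson subsetD)

lemma factor_on_1_imp_2: "factor_on A 1 s \<Longrightarrow> factor_on A 2 s"
  unfolding factor_on_1 factor_on_2
  by (elim exE, rule_tac x = u in exI, rule_tac x = "\<lambda>_. 0" in exI) simp

lemma factor_on_diag_pos: "factor_on A m s \<Longrightarrow> i \<in> A \<Longrightarrow> 0 < s i i"
  unfolding factor_on_def by (meson le_less_trans sum_nonneg zero_le_square)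

lemma factor_on_sym:
  assumes "factor_on A m s" "i \<in> A" "j \<in> A"
  shows "s i j = s j i"
proof -
  obtain g :: "'a \<Rightarrow> nat \<Rightarrow> real"
    where g: "\<forall>i\<in>A. \<forall>j\<in>A. i \<noteq> j \<longrightarrow> s i j = (\<Sum>k<m. g i k * g j k)"
    using assms unfolding factor_on_def by blast
  show ?thesis
    using g assms by (cases "i = j") (auto simp: mult.commute)
qed

text \<open>A set with fewer than \<open>n\<close> indices can be enlarged inside \<open>A\<close>
  to size exactly \<open>n\<close>. The bounded form is convenient because later arguments name
  indices that may coincide.\<close>

lemma factor_on_small_subset:
  assumes "finite A" "n \<le> card A"
    and "\<And>S. S \<subseteq> A \<Longrightarrow> card S = n \<Longrightarrow> factor_on S m s"
    and "T \<subseteq> A" "card T \<le> n"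
  shows "factor_on T m s"
proof -
  obtain S where "T \<subseteq> S" "S \<subseteq> A" "card S = n"
    using exists_subset_between[of T n A] assms by blast
  then show ?thesis using assms(3) factor_on_subset by blast
qed

text \<open>Indices outside \<open>T\<close> receive the zero vector, which is orthogonal to
  everything and shorter than any positive variance.\<close>

lemma factor_on_extend_zero:
  assumes "factor_on T m s"
    and "\<And>i. i \<in> A - T \<Longrightarrow> 0 < s i i"
    and "\<And>i j. i \<in> A \<Longrightarrow> j \<in> A \<Longrightarrow> i \<noteq> j \<Longrightarrow> i \<notin> T \<or> j \<notin> T \<Longrightarrow> s i j = 0"
  shows "factor_on A m s"
proof -
  obtain g :: "'a \<Rightarrow> nat \<Rightarrow> real"
    where g: "\<forall>i\<in>T. (\<Sum>k<m. g i k * g i k) < s i i"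
      "\<forall>i\<in>T. \<forall>j\<in>T. i \<noteq> j \<longrightarrow> s i j = (\<Sum>k<m. g i k * g j k)"
    using assms(1) unfolding factor_on_def by blast
  have "(\<Sum>k<m. (if i \<in> T then g i k else 0) * (if i \<in> T then g i k else 0)) < s i i"
    if "i \<in> A" for i
    using g(1) assms(2) that by (cases "i \<in> T") auto
  moreover have "s i j = (\<Sum>k<m. (if i \<in> T then g i k else 0) * (if j \<in> T then g j k else 0))"
    if "i \<in> A" "j \<in> A" "i \<noteq> j" for i j
    using g(2) assms(3)[of i j] that by (cases "i \<in> T"; cases "j \<in> T") auto
  ultimately show ?thesis
    unfolding factor_on_def by (intro exI[of _ "\<lambda>i k. if i \<in> T then g i k else 0"]) blast
qed

section \<open>Reindexing and the translation to matrices\<close>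

lemma factor_on_image:
  assumes "inj_on f A"
  shows "factor_on (f ` A) m s \<longleftrightarrow> factor_on A m (\<lambda>i j. s (f i) (f j))"
proof
  assume "factor_on (f ` A) m s"
  then obtain g :: "'b \<Rightarrow> nat \<Rightarrow> real"
    where "\<forall>i\<in>f ` A. (\<Sum>k<m. g i k * g i k) < s i i"
      "\<forall>i\<in>f ` A. \<forall>j\<in>f ` A. i \<noteq> j \<longrightarrow> s i j = (\<Sum>k<m. g i k * g j k)"
    unfolding factor_on_def by blast
  then show "factor_on A m (\<lambda>i j. s (f i) (f j))"
    unfolding factor_on_def using assms
    by (intro exI[of _ "\<lambda>i. g (f i)"]) (auto simp: inj_on_eq_iff)
next
  assume "factor_on A m (\<lambda>i j. s (f i) (f j))"
  then obtain g :: "'a \<Rightarrow> nat \<Rightarrow> real"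
    where "\<forall>i\<in>A. (\<Sum>k<m. g i k * g i k) < s (f i) (f i)"
      "\<forall>i\<in>A. \<forall>j\<in>A. i \<noteq> j \<longrightarrow> s (f i) (f j) = (\<Sum>k<m. g i k * g j k)"
    unfolding factor_on_def by blast
  then show "factor_on (f ` A) m s"
    unfolding factor_on_def using assms
    by (intro exI[of _ "\<lambda>i. g (the_inv_into A f i)"]) (auto simp: the_inv_into_f_f)
qed

lemma F_model_iff_factor_on:
  assumes A: "A \<in> carrier_mat n n"
  shows "A \<in> F_model n m \<longleftrightarrow> factor_on {0..<n} m (\<lambda>i j. A $$ (i, j))"
proof
  assume "A \<in> F_model n m"
  then obtain D G where D: "D \<in> carrier_mat n n" "diagonal_mat D" "\<forall>i<n. D $$ (i, i) > 0"
    and G: "G \<in> carrier_mat n m" and eq: "A = D + G * G\<^sup>T"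
    unfolding F_model_def by blast
  have "A $$ (i, j) = D $$ (i, j) + (\<Sum>k<m. G $$ (i, k) * G $$ (j, k))" if "i < n" "j < n" for i j
    using that D G by (simp add: eq scalar_prod_def atLeast0LessThan)
  then show "factor_on {0..<n} m (\<lambda>i j. A $$ (i, j))"
    unfolding factor_on_def using D
    by (intro exI[of _ "\<lambda>i k. G $$ (i, k)"]) (auto simp: diagonal_mat_def)
next
  assume "factor_on {0..<n} m (\<lambda>i j. A $$ (i, j))"
  then obtain g :: "nat \<Rightarrow> nat \<Rightarrow> real"
    where g: "\<forall>i\<in>{0..<n}. (\<Sum>k<m. g i k * g i k) < A $$ (i, i)"
      "\<forall>i\<in>{0..<n}. \<forall>j\<in>{0..<n}. i \<noteq> j \<longrightarrow> A $$ (i, j) = (\<Sum>k<m. g i k * g j k)"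
    unfolding factor_on_def by blast
  define G where "G = mat n m (\<lambda>(i, k). g i k)"
  define D where "D = mat n n (\<lambda>(i, j). if i = j then A $$ (i, i) - (\<Sum>k<m. g i k * g i k) else 0)"
  have "A = D + G * G\<^sup>T"
    by (rule eq_matI)
      (use A g in \<open>auto simp: D_def G_def scalar_prod_def atLeast0LessThan\<close>)
  moreover have "D \<in> carrier_mat n n" "diagonal_mat D" "\<forall>i<n. D $$ (i, i) > 0"
    "G \<in> carrier_mat n m"
    using g by (auto simp: D_def G_def diagonal_mat_def)
  ultimately show "A \<in> F_model n m"
    unfolding F_model_def by blast
qed

text \<open>\<open>pick S\<close> enumerates \<open>S\<close> increasingly, so the submatrix is the
  restriction to \<open>S\<close> read through an injection, and representability is invariant under
  injective reindexing.\<close>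

lemma submatrix_F_model_iff_factor_on:
  assumes A: "A \<in> carrier_mat p p" and S: "S \<subseteq> {0..<p}"
  shows "submatrix A S S \<in> F_model (card S) m \<longleftrightarrow> factor_on S m (\<lambda>i j. A $$ (i, j))"
proof -
  have fin: "finite S" using S finite_subset by blast
  have *: "{i. i < p \<and> i \<in> S} = S" using S by auto
  have carrier: "submatrix A S S \<in> carrier_mat (card S) (card S)"
    using A by (auto simp: dim_submatrix *)
  have inj: "inj_on (pick S) {0..<card S}"
    by (auto intro!: inj_onI) (metis nat_neq_iff pick_mono)
  have "pick S ` {0..<card S} \<subseteq> S"
    using pick_in_set_le by auto
  then have img: "pick S ` {0..<card S} = S"
    using card_image[OF inj] fin by (intro card_subset_eq) auto
  have "submatrix A S S \<in> F_model (card S) m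
      \<longleftrightarrow> factor_on {0..<card S} m (\<lambda>i j. submatrix A S S $$ (i, j))"
    by (rule F_model_iff_factor_on[OF carrier])
  also have "\<dots> \<longleftrightarrow> factor_on {0..<card S} m (\<lambda>i j. A $$ (pick S i, pick S j))"
    unfolding factor_on_def using A by (simp add: submatrix_index *)
  also have "\<dots> \<longleftrightarrow> factor_on S m (\<lambda>i j. A $$ (i, j))"
    using factor_on_image[OF inj, of m "\<lambda>i j. A $$ (i, j)"] by (simp add: img)
  finally show ?thesis .
qed

section \<open>One factor\<close>

text \<open>The triangle forces \<open>u a * u a = s a b * s a c / s b c\<close>, which is positive
  by \<open>pos\<close>, and then \<open>u i = s a i / u a\<close> for all other \<open>i\<close>.
  The tetrads give consistency off the diagonal; every \<open>u i * u i\<close> is a quotient of the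
  kind bounded in \<open>diag\<close>.\<close>

lemma rank_one_factor_on_1:
  assumes sym: "\<And>i j. i \<in> A \<Longrightarrow> j \<in> A \<Longrightarrow> s i j = s j i"
    and tetrad: "\<And>a b c d. {a, b, c, d} \<subseteq> A \<Longrightarrow> distinct [a, b, c, d] \<Longrightarrow>
      s a c * s b d = s a d * s b c"
    and abc: "{a, b, c} \<subseteq> A" "distinct [a, b, c]"
    and pos: "0 < s a b * s a c * s b c"
    and diag: "\<And>i j k. {i, j, k} \<subseteq> A \<Longrightarrow> distinct [i, j, k] \<Longrightarrow> s j k \<noteq> 0 \<Longrightarrow>
      s i j * s i k / s j k < s i i"
  shows "factor_on A 1 s"
proof -
  have nz: "s a b \<noteq> 0" "s a c \<noteq> 0" "s b c \<noteq> 0" using pos by auto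
  define q where "q = s a b * s a c / s b c"
  have "q = s a b * s a c * s b c / (s b c)\<^sup>2" using nz by (simp add: q_def power2_eq_square)
  then have "q > 0" using pos nz by simp
  define g where "g = sqrt q"
  have g: "g * g = q" "g \<noteq> 0" using \<open>q > 0\<close> by (auto simp: g_def)
  define u where "u i = (if i = a then g else s a i / g)" for i
  have uu: "u i * u j = s a i * s a j / q" if "i \<noteq> a" "j \<noteq> a" for i j
    using that by (simp add: u_def flip: g(1))
  have ab: "s a k * s b c = s b k * s a c" if "k \<in> A" "k \<notin> {a, b, c}" for k
    using tetrad[of a b k c] that abc by (auto simp: mult.commute)
  \<comment> \<open>Pairs containing \<open>b\<close> come first, from the definition of
    \<open>q\<close> and from \<open>ab\<close>. A tetrad reduces any other pair to these, and
    \<open>s a b\<close> cancels.\<close>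
  have off: "s i j * q = s a i * s a j" if ij: "i \<in> A" "j \<in> A" "i \<noteq> j" "i \<noteq> a" "j \<noteq> a" for i j
  proof -
    have b: "s b k * q = s a b * s a k" if k: "k \<in> A" "k \<noteq> a" "k \<noteq> b" for k
    proof (cases "k = c")
      case False
      then have "s a k * s b c = s b k * s a c" using ab k by auto
      then show ?thesis using nz by (simp add: q_def field_simps)
    qed (use nz in \<open>simp add: q_def\<close>)
    consider "i = b" | "j = b" | "i \<noteq> b" "j \<noteq> b" by blast
    then show ?thesis
    proof cases
      case 1 then show ?thesis using b[of j] ij by simp
    next
      case 2 then show ?thesis using b[of i] ij sym[of i j] by simp
    next
      case 3
      have "s a b * s i j = s a i * s b j"
        using tetrad[of a j b i] ij 3 abc sym[of i j] sym[of b j] by (auto simp: mult.commute)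
      moreover have "s b j * q = s a b * s a j" using b[of j] ij 3 by simp
      ultimately have "s a b * (s i j * q) = s a b * (s a i * s a j)"
        by (metis mult.assoc mult.left_commute)
      then show ?thesis using nz by simp
    qed
  qed
  have "s i j = u i * u j" if "i \<in> A" "j \<in> A" "i \<noteq> j" for i j
  proof -
    consider "i = a" | "j = a" | "i \<noteq> a" "j \<noteq> a" by blast
    then show ?thesis
    proof cases
      case 1 then show ?thesis using g that by (simp add: u_def)
    next
      case 2 then show ?thesis using g that sym[of i a] by (simp add: u_def)
    next
      case 3 then show ?thesis using off that \<open>q > 0\<close> by (simp add: uu field_simps)
    qed
  qed
  moreover have "u i * u i < s i i" if "i \<in> A" for i
  proof -
    \<comment> \<open>Each case uses a side of the triangle that avoids \<open>i\<close>:
      \<open>b, c\<close>, then \<open>a, c\<close>, then \<open>a, b\<close>.\<close>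
    consider "i = a" | "i = b" | "i \<noteq> a" "i \<noteq> b" by blast
    then show ?thesis
    proof cases
      case 1
      then show ?thesis using diag[of a b c] abc nz g by (auto simp: u_def q_def)
    next
      case 2
      have "u b * u b = s b a * s b c / s a c"
        using nz uu[of b b] abc sym[of a b] by (auto simp: q_def field_simps)
      then show ?thesis using 2 diag[of b a c] abc nz by auto
    next
      case 3
      have "s i b * q = s a i * s a b" using off[of i b] that 3 abc by auto
      then have "s a i / q = s i b / s a b" using nz \<open>q > 0\<close> by (simp add: field_simps)
      then have "u i * u i = s i a * s i b / s a b"
        using uu[of i i] 3 sym[of a i] abc that by (metis insert_subset times_divide_eq_right)
      then show ?thesis using 3 that diag[of i a b] abc nz by auto
    qed
  qed
  ultimately show ?thesis unfolding factor_on_1 by blast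
qed

text \<open>A triangle of nonzero covariances reduces the claim to
  \<open>rank_one_factor_on_1\<close>, each of whose conditions involves at most four indices.
  Without a triangle at most one pair has nonzero covariance, and its representation extends by
  zero.\<close>

theorem one_factor_finiteness:
  assumes loc: "\<And>T. T \<subseteq> A \<Longrightarrow> card T \<le> 4 \<Longrightarrow> factor_on T 1 s"
  shows "factor_on A 1 s"
proof -
  \<comment> \<open>No distinctness is assumed, so pairs and triples are handled by repeating an
    index.\<close>
  have card4: "card {a, b, c, d} \<le> 4" for a b c d :: 'a
    by (rule card_insert_le_m1 | simp)+
  have loc4: "\<exists>u. \<forall>i\<in>{a, b, c, d}. u i * u i < s i i \<and>
      (\<forall>j\<in>{a, b, c, d}. i \<noteq> j \<longrightarrow> s i j = u i * u j)" if "{a, b, c, d} \<subseteq> A" for a b c d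
    using loc[OF that card4] unfolding factor_on_1 by blast
  have sym: "s i j = s j i" if "i \<in> A" "j \<in> A" for i j
    using factor_on_sym[OF loc[of "{i, j, i, i}"], of i j] card4[of i j i i] that by auto
  have diag_pos: "0 < s i i" if "i \<in> A" for i
    using factor_on_diag_pos[OF loc[of "{i}"], of i] that by auto
  show ?thesis
  proof (cases "\<exists>a b c. {a, b, c} \<subseteq> A \<and> distinct [a, b, c] \<and> s a b \<noteq> 0 \<and> s a c \<noteq> 0 \<and> s b c \<noteq> 0")
    case True
    then obtain a b c where abc: "{a, b, c} \<subseteq> A" "distinct [a, b, c]"
      and nz: "s a b \<noteq> 0" "s a c \<noteq> 0" "s b c \<noteq> 0" by blast
    show ?thesis
    proof (rule rank_one_factor_on_1[OF sym _ abc])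
      show "s a c * s b d = s a d * s b c"
        if sub: "{a, b, c, d} \<subseteq> A" and dist: "distinct [a, b, c, d]" for a b c d
      proof -
        obtain u where "\<forall>i\<in>{a, b, c, d}. u i * u i < s i i \<and>
            (\<forall>j\<in>{a, b, c, d}. i \<noteq> j \<longrightarrow> s i j = u i * u j)" using loc4[OF sub] by blast
        then show ?thesis using dist by simp
      qed
      obtain u where "\<forall>i\<in>{a, b, c, c}. u i * u i < s i i \<and>
            (\<forall>j\<in>{a, b, c, c}. i \<noteq> j \<longrightarrow> s i j = u i * u j)"
        using loc4[of a b c c] abc by auto
      then have *: "s a b = u a * u b" "s a c = u a * u c" "s b c = u b * u c"
        using abc by auto
      then have "s a b * s a c * s b c = (u a * u b * u c)\<^sup>2"
        by (simp add: power2_eq_square)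
      moreover have "u a * u b * u c \<noteq> 0" using nz * by auto
      ultimately show "0 < s a b * s a c * s b c" by (metis zero_less_power2)
      show "s i j * s i k / s j k < s i i"
        if sub: "{i, j, k} \<subseteq> A" and dist: "distinct [i, j, k]" and "s j k \<noteq> 0" for i j k
      proof -
        obtain u where "\<forall>i\<in>{i, j, k, k}. u i * u i < s i i \<and>
            (\<forall>l\<in>{i, j, k, k}. i \<noteq> l \<longrightarrow> s i l = u i * u l)"
          using loc4[of i j k k] sub by auto
        then show ?thesis using dist \<open>s j k \<noteq> 0\<close> by auto
      qed
    qed auto
  next
    case no_triangle: False
    show ?thesis
    proof (cases "\<exists>a b. a \<in> A \<and> b \<in> A \<and> a \<noteq> b \<and> s a b \<noteq> 0")
      case True
      then obtain a b where ab: "a \<in> A" "b \<in> A" "a \<noteq> b" "s a b \<noteq> 0" by blast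
      \<comment> \<open>A nonzero \<open>s i j\<close> makes \<open>u i\<close>, \<open>u a\<close>
        and \<open>u b\<close> all nonzero, so \<open>i, a, b\<close> would be a triangle.\<close>
      have zero: "s i j = 0" if ij: "i \<in> A" "j \<in> A" "i \<noteq> j" "i \<notin> {a, b}" for i j
      proof (rule ccontr)
        assume nz: "s i j \<noteq> 0"
        have "{i, j, a, b} \<subseteq> A" using ij ab by simp
        from loc4[OF this] obtain u where u: "\<forall>k\<in>{i, j, a, b}. u k * u k < s k k \<and>
            (\<forall>l\<in>{i, j, a, b}. k \<noteq> l \<longrightarrow> s k l = u k * u l)" by blast
        have "u i \<noteq> 0" "u a \<noteq> 0" "u b \<noteq> 0" using u nz ab ij by auto
        then have "s a i \<noteq> 0" "s b i \<noteq> 0" using u ij by auto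
        then show False using no_triangle ab ij by auto
      qed
      have "s i j = 0" if "i \<in> A" "j \<in> A" "i \<noteq> j" "j \<notin> {a, b}" for i j
        using zero[of j i] sym[of i j] that by simp
      then show ?thesis
        by (intro factor_on_extend_zero[of "{a, b}" 1 s A])
          (use ab zero diag_pos loc[of "{a, b}"] in \<open>auto simp: card_insert_if\<close>)
    next
      case False
      then show ?thesis
        by (intro factor_on_extend_zero[of "{}" 1 s A]) (use diag_pos in \<open>auto simp: factor_on_def\<close>)
    qed
  qed
qed

section \<open>Constraints on vectors in the plane\<close>

text \<open>Dependence of three plane vectors, combined with the tetrads, forces the squared length
  of \<open>j\<close> or of \<open>k\<close> to take its one-factor value, for instance
  \<open>x j = s i j * s j k / s i k\<close>. This gives the sign, and Cauchy-Schwarz for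
  \<open>i\<close> and that index gives
  \<open>s i j * s i k / s j k \<le> x i < s i i\<close>.\<close>

lemma factor_on_2_four_clique:
  assumes fac: "factor_on {i, j, k, l} 2 s" and dist: "distinct [i, j, k, l]"
    and nz: "s i j \<noteq> 0" "s i k \<noteq> 0" "s j k \<noteq> 0" "s i l \<noteq> 0"
    and tetrad: "s k l * s i j = s i l * s j k" "s j l * s i k = s i l * s j k"
  shows "0 < s i j * s i k * s j k" "s i j * s i k / s j k < s i i"
proof -
  obtain u v where uv: "\<forall>a\<in>{i, j, k, l}. u a * u a + v a * v a < s a a"
    "\<forall>a\<in>{i, j, k, l}. \<forall>b\<in>{i, j, k, l}. a \<noteq> b \<longrightarrow> s a b = u a * u b + v a * v b"
    using fac unfolding factor_on_2 by blast
  define x where "x a = u a * u a + v a * v a" for a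
  have s_eq: "s i j = u i * u j + v i * v j" "s i k = u i * u k + v i * v k"
    "s j k = u j * u k + v j * v k" "s i l = u i * u l + v i * v l"
    "s j l = u j * u l + v j * v l" "s k l = u k * u l + v k * v l"
    using uv(2) dist by auto
  \<comment> \<open>the minor of the Gram matrix with rows \<open>j, k, i\<close> and columns \<open>j, k, l\<close>\<close>
  have minor: "x j * x k * s i l - x j * s i k * s k l - s j k * s j k * s i l
      + s j k * s k l * s i j + s j l * s j k * s i k - s j l * s i j * x k = 0"
    unfolding s_eq x_def by (simp add: algebra_simps)
  \<comment> \<open>The product of the two deviations from the one-factor values is written as a
    combination of the minor and the two tetrads, all of which vanish.\<close>
  have "s i l * ((x j * s i k - s i j * s j k) * (x k * s i j - s i k * s j k)) =
      s i k * s i j * (x j * x k * s i l - x j * s i k * s k l - s j k * s j k * s i l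
        + s j k * s k l * s i j + s j l * s j k * s i k - s j l * s i j * x k)
      + (s i j * s j k - x j * s i k) * s i k * (s i l * s j k - s k l * s i j)
      + (s i k * s j k - x k * s i j) * s i j * (s i l * s j k - s j l * s i k)"
    by (simp add: algebra_simps)
  then have "s i l * ((x j * s i k - s i j * s j k) * (x k * s i j - s i k * s j k)) = 0"
    using minor tetrad by simp
  then have e0: "x j * s i k = s i j * s j k \<or> x k * s i j = s i k * s j k"
    using nz by simp
  \<comment> \<open>Both alternatives at once: \<open>q, r\<close> stands for \<open>j, k\<close> or
    for \<open>k, j\<close>.\<close>
  have res: "0 < s i j * s i k * s j k \<and> s i j * s i k / s j k \<le> x i"
    if xq: "x q * s i r = s i q * s q r" and q: "s q r = s j k" "s i q * s i r = s i j * s i k"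
      and xs: "s i q = u i * u q + v i * v q" and nz': "s i q \<noteq> 0" "s i r \<noteq> 0" for q r
  proof -
    have "x q \<noteq> 0" using xq q nz nz' by auto
    then have xpos: "x q > 0" unfolding x_def by (metis sum_squares_gt_zero_iff sum_squares_eq_zero_iff)
    have e: "s i j * s i k * s j k = x q * (s i r * s i r)"
      using xq q by (metis mult.assoc mult.commute)
    then have pos: "0 < s i j * s i k * s j k" using xpos nz' by (simp add: zero_less_mult_iff) (metis linorder_neqE)
    have "x i * x q - s i q * s i q = (u i * v q - v i * u q)\<^sup>2"
      unfolding xs x_def by (simp add: algebra_simps power2_eq_square)
    then have cs: "s i q * s i q \<le> x i * x q" by (metis diff_ge_0_iff_ge zero_le_power2)
    have "s i j * s i k / s j k = s i q * s i r / s q r" using q by simp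
    also have "s q r = x q * s i r / s i q" using xq nz' by (simp add: field_simps)
    also have "s i q * s i r / (x q * s i r / s i q) = s i q * s i q / x q"
      using nz' by simp
    also have "\<dots> \<le> x i" using cs xpos by (simp add: field_simps)
    finally show ?thesis using pos by simp
  qed
  from e0 have "0 < s i j * s i k * s j k \<and> s i j * s i k / s j k \<le> x i"
  proof
    assume "x j * s i k = s i j * s j k"
    then show ?thesis by (rule res) (use nz s_eq in auto)
  next
    assume e: "x k * s i j = s i k * s j k"
    have kj: "s k j = s j k" using uv(2) dist by (auto simp: mult.commute)
    show ?thesis by (rule res[of k j]) (use e nz s_eq kj in auto)
  qed
  moreover have "x i < s i i" using uv(1) by (simp add: x_def)
  ultimately show "0 < s i j * s i k * s j k" "s i j * s i k / s j k < s i i" by auto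
qed

lemma orthogonal_plane_vectors:
  fixes a1 a2 b1 b2 c1 c2 :: real
  assumes "a1 * b1 + a2 * b2 = 0" "a1 * c1 + a2 * c2 = 0" "b1 * c1 + b2 * c2 = 0"
  shows "(a1 = 0 \<and> a2 = 0) \<or> (b1 = 0 \<and> b2 = 0) \<or> (c1 = 0 \<and> c2 = 0)"
proof -
  \<comment> \<open>the determinant of the Gram matrix of three plane vectors vanishes\<close>
  have "(a1 * a1 + a2 * a2) * ((b1 * b1 + b2 * b2) * (c1 * c1 + c2 * c2)) =
      (a1 * a1 + a2 * a2) * (b1 * c1 + b2 * c2)\<^sup>2 + (b1 * b1 + b2 * b2) * (a1 * c1 + a2 * c2)\<^sup>2
      + (c1 * c1 + c2 * c2) * (a1 * b1 + a2 * b2)\<^sup>2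
      - 2 * (a1 * b1 + a2 * b2) * (b1 * c1 + b2 * c2) * (a1 * c1 + a2 * c2)"
    by (simp add: algebra_simps power2_eq_square)
  then have "(a1 * a1 + a2 * a2) * ((b1 * b1 + b2 * b2) * (c1 * c1 + c2 * c2)) = 0"
    using assms by simp
  then show ?thesis by (simp add: sum_squares_eq_zero_iff)
qed

section \<open>Two factors with a nonzero tetrad\<close>

lemma factor_on_2_nonzero_tetrad:
  assumes abcd: "{a, b, c, d} \<subseteq> A" "distinct [a, b, c, d]"
    and D_nz: "s a c * s b d - s a d * s b c \<noteq> 0"
    and loc: "\<And>T. T \<subseteq> A \<Longrightarrow> card T \<le> 6 \<Longrightarrow> factor_on T 2 s"
  shows "factor_on A 2 s"
proof -
  \<comment> \<open>Cramer's rule: \<open>D\<close> is the determinant of the covariances of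
    \<open>a, b\<close> with \<open>c, d\<close>; \<open>P k\<close> and \<open>Q k\<close> replace
    the column of \<open>c\<close>, respectively of \<open>d\<close>, by that of
    \<open>k\<close>.\<close>
  define D where "D = s a c * s b d - s a d * s b c"
  define P where "P k = s a k * s b d - s b k * s a d" for k
  define Q where "Q k = s a c * s b k - s b c * s a k" for k
  define F where "F = {a, b, c, d}"
  have "D \<noteq> 0" using D_nz by (simp add: D_def)
  have loc6: "\<exists>u v. (\<forall>i\<in>{a, b, c, d, k, l}. u i * u i + v i * v i < s i i) \<and>
      (\<forall>i\<in>{a, b, c, d, k, l}. \<forall>j\<in>{a, b, c, d, k, l}. i \<noteq> j \<longrightarrow> s i j = u i * u j + v i * v j)"
    if "k \<in> A" "l \<in> A" for k l
  proof -
    have "card {a, b, c, d, k, l} \<le> 6" by (rule card_insert_le_m1 | simp)+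
    then have "factor_on {a, b, c, d, k, l} 2 s" using loc abcd that by simp
    then show ?thesis unfolding factor_on_2 .
  qed
  have sym: "s i j = s j i" if "i \<in> A" "j \<in> A" for i j
    using factor_on_sym[OF loc[of "{i, j}"], of i j] that by (auto simp: card_insert_if)
  have coord: "D * u k = P k * u c + Q k * u d" "D * v k = P k * v c + Q k * v d"
    if "\<forall>i\<in>X. \<forall>j\<in>X. i \<noteq> j \<longrightarrow> s i j = u i * u j + v i * v j" "F \<subseteq> X" "k \<in> X" "k \<notin> F" for u v X k
  proof -
    have "s a c = u a * u c + v a * v c" "s a d = u a * u d + v a * v d"
      "s b c = u b * u c + v b * v c" "s b d = u b * u d + v b * v d"
      "s a k = u a * u k + v a * v k" "s b k = u b * u k + v b * v k"
      using that abcd by (auto simp: F_def)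
    then show "D * u k = P k * u c + Q k * u d" "D * v k = P k * v c + Q k * v d"
      unfolding D_def P_def Q_def by (simp_all add: algebra_simps)
  qed
  have cov: "D * (u k * y + v k * z) = P k * (u c * y + v c * z) + Q k * (u d * y + v d * z)"
    if "D * u k = P k * u c + Q k * u d" "D * v k = P k * v c + Q k * v d"
    for u v k and y z :: real
  proof -
    have "D * (u k * y + v k * z) = (D * u k) * y + (D * v k) * z" by (simp add: algebra_simps)
    then show ?thesis unfolding that by (simp add: algebra_simps)
  qed
  \<comment> \<open>If some index outside \<open>F\<close> has nonzero \<open>P\<close>, then
    \<open>i\<close> is one of them; otherwise \<open>i\<close> is any element of \<open>A\<close>.
    The choice of \<open>j\<close> does the same for \<open>Q\<close>.\<close>
  obtain i where i: "i \<in> A" "\<And>k. k \<in> A - F \<Longrightarrow> P k \<noteq> 0 \<Longrightarrow> i \<notin> F \<and> P i \<noteq> 0"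
    using abcd(1) by (metis DiffD1 DiffD2 insert_subset)
  obtain j where j: "j \<in> A" "\<And>k. k \<in> A - F \<Longrightarrow> Q k \<noteq> 0 \<Longrightarrow> j \<notin> F \<and> Q j \<noteq> 0"
    using abcd(1) by (metis DiffD1 DiffD2 insert_subset)
  obtain u v where uv: "\<forall>k\<in>{a, b, c, d, i, j}. u k * u k + v k * v k < s k k"
    "\<forall>k\<in>{a, b, c, d, i, j}. \<forall>l\<in>{a, b, c, d, i, j}. k \<noteq> l \<longrightarrow> s k l = u k * u l + v k * v l"
    using loc6[OF i(1) j(1)] by blast
  \<comment> \<open>The representation of the 6-set is kept on \<open>F\<close> and continued to all
    other indices by Cramer's rule.\<close>
  define U where "U k = (if k \<in> F then u k else (P k * u c + Q k * u d) / D)" for k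
  define V where "V k = (if k \<in> F then v k else (P k * v c + Q k * v d) / D)" for k
  have UF: "U k = u k" "V k = v k" if "k \<in> F" for k using that by (simp_all add: U_def V_def)
  have UV: "D * U k = P k * u c + Q k * u d" "D * V k = P k * v c + Q k * v d" if "k \<notin> F" for k
    using that \<open>D \<noteq> 0\<close> by (simp_all add: U_def V_def)
  have F_in: "a \<in> F" "b \<in> F" "c \<in> F" "d \<in> F" by (auto simp: F_def)
  have UVcov: "D * (U k * y + V k * z) = P k * (u c * y + v c * z) + Q k * (u d * y + v d * z)"
    if "k \<notin> F" for k and y z :: real
    using cov[of U k V y z] UV[OF that] UF F_in by simp
  \<comment> \<open>Covariances with \<open>a\<close> and \<open>b\<close> follow from the
    determinants alone, with no squared length involved.\<close>
  have out_a: "U k * u a + V k * v a = s k a" and out_b: "U k * u b + V k * v b = s k b"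
    if k: "k \<in> A" "k \<notin> F" for k
  proof -
    have "D * (U k * u a + V k * v a) = P k * s a c + Q k * s a d"
      using UVcov[OF k(2), of "u a" "v a"] uv(2) abcd(2) by (auto simp: mult.commute)
    also have "\<dots> = D * s k a"
      using sym[of k a] k abcd(1) by (simp add: P_def Q_def D_def algebra_simps)
    finally show "U k * u a + V k * v a = s k a" using \<open>D \<noteq> 0\<close> by simp
    have "D * (U k * u b + V k * v b) = P k * s b c + Q k * s b d"
      using UVcov[OF k(2), of "u b" "v b"] uv(2) abcd(2) by (auto simp: mult.commute)
    also have "\<dots> = D * s k b"
      using sym[of k b] k abcd(1) by (simp add: P_def Q_def D_def algebra_simps)
    finally show "U k * u b + V k * v b = s k b" using \<open>D \<noteq> 0\<close> by simp
  qed
  \<comment> \<open>The inner product with the vector of \<open>c\<close> leaves its squared length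
    as the only term that is not a covariance, so an index with nonzero \<open>P\<close> determines
    it; likewise for \<open>d\<close> and \<open>Q\<close>.\<close>
  have cov_c: "D * s k c = P k * (u c * u c + v c * v c) + Q k * s d c"
    and cov_d: "D * s k d = P k * s c d + Q k * (u d * u d + v d * v d)"
    if uv: "\<forall>i\<in>X. \<forall>j\<in>X. i \<noteq> j \<longrightarrow> s i j = u i * u j + v i * v j"
      and k: "F \<subseteq> X" "k \<in> X" "k \<notin> F" for u v X k
  proof -
    have "s k c = u k * u c + v k * v c" "s k d = u k * u d + v k * v d"
      "s d c = u d * u c + v d * v c" "s c d = u c * u d + v c * v d"
      using uv k abcd by (auto simp: F_def)
    then show "D * s k c = P k * (u c * u c + v c * v c) + Q k * s d c"
      "D * s k d = P k * s c d + Q k * (u d * u d + v d * v d)"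
      using cov[OF coord[OF uv k]] by simp_all
  qed
  have out_c: "U k * u c + V k * v c = s k c" if k: "k \<in> A" "k \<notin> F" for k
  proof -
    obtain u' v' where uv': "\<forall>m\<in>{a, b, c, d, i, k}. \<forall>l\<in>{a, b, c, d, i, k}. m \<noteq> l \<longrightarrow>
        s m l = u' m * u' l + v' m * v' l"
      using loc6[OF i(1) k(1)] by blast
    \<comment> \<open>When \<open>P k\<close> is nonzero, both representations contain
      \<open>i\<close> with \<open>P i\<close> nonzero, so they agree on the squared length of
      \<open>c\<close>; when \<open>P k = 0\<close> that length does not matter.\<close>
    have "P k * (u' c * u' c + v' c * v' c) = P k * (u c * u c + v c * v c)"
    proof (cases "P k = 0")
      case False
      then have "i \<notin> F" "P i \<noteq> 0" using i(2) k by auto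
      then show ?thesis using cov_c[OF uv', of i] cov_c[OF uv(2), of i] by (auto simp: F_def)
    qed simp
    then have "D * s k c = P k * (u c * u c + v c * v c) + Q k * s d c"
      using cov_c[OF uv', of k] k by (auto simp: F_def)
    also have "\<dots> = D * (U k * u c + V k * v c)"
      using UVcov[OF k(2), of "u c" "v c"] uv(2) abcd(2) by auto
    finally show ?thesis using \<open>D \<noteq> 0\<close> by simp
  qed
  have out_d: "U k * u d + V k * v d = s k d" if k: "k \<in> A" "k \<notin> F" for k
  proof -
    obtain u' v' where uv': "\<forall>m\<in>{a, b, c, d, j, k}. \<forall>l\<in>{a, b, c, d, j, k}. m \<noteq> l \<longrightarrow>
        s m l = u' m * u' l + v' m * v' l"
      using loc6[OF j(1) k(1)] by blast
    have "Q k * (u' d * u' d + v' d * v' d) = Q k * (u d * u d + v d * v d)"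
    proof (cases "Q k = 0")
      case False
      then have "j \<notin> F" "Q j \<noteq> 0" using j(2) k by auto
      then show ?thesis using cov_d[OF uv', of j] cov_d[OF uv(2), of j] by (auto simp: F_def)
    qed simp
    then have "D * s k d = P k * s c d + Q k * (u d * u d + v d * v d)"
      using cov_d[OF uv', of k] k by (auto simp: F_def)
    also have "\<dots> = D * (U k * u d + V k * v d)"
      using UVcov[OF k(2), of "u d" "v d"] uv(2) abcd(2) by auto
    finally show ?thesis using \<open>D \<noteq> 0\<close> by simp
  qed
  have out_F: "U k * U m + V k * V m = s k m" if "k \<in> A" "k \<notin> F" "m \<in> F" for k m
    using out_a[OF that(1,2)] out_b[OF that(1,2)] out_c[OF that(1,2)] out_d[OF that(1,2)]
      UF[OF that(3)] that(3) by (auto simp: F_def)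
  \<comment> \<open>The right side contains covariances only, so the left side can be compared with
    any local representation; \<open>k = l\<close> is allowed and handles the diagonal.\<close>
  have out_out: "D * (U k * U l + V k * V l) = P k * s c l + Q k * s d l"
    if kl: "k \<in> A" "k \<notin> F" "l \<in> A" "l \<notin> F" for k l
    using UVcov[OF kl(2), of "U l" "V l"] out_c[OF kl(3,4)] out_d[OF kl(3,4)]
      sym[of l c] sym[of l d] kl abcd(1) by (simp add: mult.commute)
  have "U k * U k + V k * V k < s k k" if k: "k \<in> A" for k
  proof (cases "k \<in> F")
    case True
    then show ?thesis using uv(1) UF[of k] by (auto simp: F_def)
  next
    case False
    obtain u' v' where uv': "\<forall>m\<in>{a, b, c, d, k, k}. u' m * u' m + v' m * v' m < s m m"
      "\<forall>m\<in>{a, b, c, d, k, k}. \<forall>l\<in>{a, b, c, d, k, k}. m \<noteq> l \<longrightarrow> s m l = u' m * u' l + v' m * v' l"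
      using loc6[OF k k] by blast
    have "D * u' k = P k * u' c + Q k * u' d" "D * v' k = P k * v' c + Q k * v' d"
      using coord[OF uv'(2), of k] False by (auto simp: F_def)
    from cov[OF this, of "u' k" "v' k"]
    moreover have "s c k = u' c * u' k + v' c * v' k" "s d k = u' d * u' k + v' d * v' k"
      using uv'(2) False by (auto simp: F_def)
    ultimately have "D * (u' k * u' k + v' k * v' k) = P k * s c k + Q k * s d k" by simp
    also have "\<dots> = D * (U k * U k + V k * V k)" using out_out k False by simp
    finally show ?thesis using uv'(1) \<open>D \<noteq> 0\<close> by simp
  qed
  moreover have "s k l = U k * U l + V k * V l" if kl: "k \<in> A" "l \<in> A" "k \<noteq> l" for k l
  proof -
    consider "k \<in> F" "l \<in> F" | "k \<in> F" "l \<notin> F" | "k \<notin> F" "l \<in> F" | "k \<notin> F" "l \<notin> F" by blast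
    then show ?thesis
    proof cases
      case 1
      then show ?thesis using uv(2) UF kl by (auto simp: F_def)
    next
      case 2
      then show ?thesis using out_F[of l k] sym[of k l] kl by (simp add: mult.commute)
    next
      case 3
      then show ?thesis using out_F[of k l] kl by simp
    next
      case 4
      obtain u' v' where uv': "\<forall>m\<in>{a, b, c, d, k, l}. \<forall>n\<in>{a, b, c, d, k, l}. m \<noteq> n \<longrightarrow>
          s m n = u' m * u' n + v' m * v' n"
        using loc6[OF kl(1,2)] by blast
      have "D * u' k = P k * u' c + Q k * u' d" "D * v' k = P k * v' c + Q k * v' d"
        using coord[OF uv', of k] 4 by (auto simp: F_def)
      from cov[OF this, of "u' l" "v' l"]
      moreover have "s c l = u' c * u' l + v' c * v' l" "s d l = u' d * u' l + v' d * v' l"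
        "s k l = u' k * u' l + v' k * v' l"
        using uv' 4 kl(3) by (auto simp: F_def)
      ultimately have "D * s k l = P k * s c l + Q k * s d l" by simp
      also have "\<dots> = D * (U k * U l + V k * V l)" using out_out kl 4 by simp
      finally show ?thesis using \<open>D \<noteq> 0\<close> by simp
    qed
  qed
  ultimately show ?thesis unfolding factor_on_2 by blast
qed

section \<open>Two factors with vanishing tetrads\<close>

text \<open>View nonzero covariances as edges of a graph with non-isolated vertices
  \<open>N\<close>. If \<open>N\<close> has at least four elements, a triangle yields the one-factor
  model, while a triangle-free graph contradicts representability in the plane.\<close>

lemma factor_on_2_zero_tetrads:
  assumes tetrad: "\<And>a b c d. {a, b, c, d} \<subseteq> A \<Longrightarrow> distinct [a, b, c, d] \<Longrightarrow>
      s a c * s b d = s a d * s b c"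
    and loc: "\<And>T. T \<subseteq> A \<Longrightarrow> card T \<le> 4 \<Longrightarrow> factor_on T 2 s"
  shows "factor_on A 2 s"
proof -
  have card4: "card {a, b, c, d} \<le> 4" for a b c d :: 'a
    by (rule card_insert_le_m1 | simp)+
  have sym: "s i j = s j i" if "i \<in> A" "j \<in> A" for i j
    using factor_on_sym[OF loc[of "{i, j, i, i}"], of i j] card4[of i j i i] that by auto
  have diag_pos: "0 < s i i" if "i \<in> A" for i
    using factor_on_diag_pos[OF loc[of "{i}"], of i] that by auto
  \<comment> \<open>The three pairings of four indices have equal products, so two disjoint edges
    force all six covariances to be nonzero.\<close>
  have match: "s a c \<noteq> 0 \<and> s b d \<noteq> 0 \<and> s a d \<noteq> 0 \<and> s b c \<noteq> 0"
    if "{a, b, c, d} \<subseteq> A" "distinct [a, b, c, d]" "s a b \<noteq> 0" "s c d \<noteq> 0" for a b c d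
  proof -
    have "s a b * s c d = s a d * s b c"
      using tetrad[of a c b d] sym[of b c] that by auto
    moreover have "s a c * s b d = s a d * s b c" using tetrad that by blast
    ultimately show ?thesis using that by (metis mult_eq_0_iff)
  qed
  define N where "N = {i \<in> A. \<exists>j\<in>A. j \<noteq> i \<and> s i j \<noteq> 0}"
  have N_sub: "N \<subseteq> A" by (auto simp: N_def)
  show ?thesis
  proof (cases "card N \<le> 3")
    case True
    have "factor_on N 2 s" using loc[OF N_sub] True by simp
    moreover have "s i j = 0" if "i \<in> A" "j \<in> A" "i \<noteq> j" "i \<notin> N \<or> j \<notin> N" for i j
      using that sym[of i j] unfolding N_def by auto
    ultimately show ?thesis using diag_pos by (intro factor_on_extend_zero[of N 2 s A]) blast+
  next
    case False
    have fresh: "\<exists>l\<in>N. l \<notin> X" if "card X \<le> 3" "finite X" for X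
    proof (rule ccontr)
      assume "\<not> ?thesis"
      then have "card N \<le> card X" using that by (intro card_mono) auto
      then show False using False that by simp
    qed
    show ?thesis
    proof (cases "\<exists>a b c. {a, b, c} \<subseteq> A \<and> distinct [a, b, c] \<and> s a b \<noteq> 0 \<and> s a c \<noteq> 0 \<and> s b c \<noteq> 0")
      case True
      then obtain a b c where abc: "{a, b, c} \<subseteq> A" "distinct [a, b, c]"
        "s a b \<noteq> 0" "s a c \<noteq> 0" "s b c \<noteq> 0" by blast
      \<comment> \<open>A fourth vertex \<open>l\<close> of \<open>N\<close> is joined to the
        triangle: a neighbour \<open>m\<close> inside the triangle is transferred to
        \<open>i\<close> by a tetrad, and one outside gives disjoint edges \<open>i j\<close> and
        \<open>l m\<close>.\<close>
      have clique: "0 < s i j * s i k * s j k \<and> s i j * s i k / s j k < s i i"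
        if ijk: "{i, j, k} \<subseteq> A" "distinct [i, j, k]" and nz: "s i j \<noteq> 0" "s i k \<noteq> 0" "s j k \<noteq> 0"
        for i j k
      proof -
        have "card {i, j, k} \<le> 3" by (rule card_insert_le_m1 | simp)+
        then obtain l where l: "l \<in> N" "l \<notin> {i, j, k}" using fresh by blast
        then obtain m where m: "l \<in> A" "m \<in> A" "m \<noteq> l" "s l m \<noteq> 0" unfolding N_def by auto
        have dist: "distinct [i, j, k, l]" and sub: "{i, j, k, l} \<subseteq> A" using ijk l m by auto
        have t: "s k l * s i j = s i l * s j k" "s j l * s i k = s i l * s j k"
          using tetrad[of i k j l] tetrad[of i j k l] sym[of j k] dist sub by (auto simp: mult.commute)
        have "s i l \<noteq> 0"
        proof -
          consider "m = i" | "m = j" | "m = k" | "m \<notin> {i, j, k}" by blast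
          then show ?thesis
          proof cases
            case 1 then show ?thesis using m sym[of i l] by auto
          next
            case 2 then show ?thesis using m t nz sym[of j l] by (metis mult_eq_0_iff)
          next
            case 3 then show ?thesis using m t nz sym[of k l] by (metis mult_eq_0_iff)
          next
            case 4 then show ?thesis using match[of i j l m] m sub dist nz by auto
          qed
        qed
        then show ?thesis
          using factor_on_2_four_clique[OF loc[OF sub card4] dist nz _ t] by blast
      qed
      have "factor_on A 1 s"
      proof (rule rank_one_factor_on_1[OF sym tetrad abc(1,2)])
        show "0 < s a b * s a c * s b c" using clique abc by blast
        show "s i j * s i k / s j k < s i i"
          if "{i, j, k} \<subseteq> A" "distinct [i, j, k]" "s j k \<noteq> 0" for i j k
          using clique[of i j k] diag_pos[of i] that by (cases "s i j = 0 \<or> s i k = 0") auto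
      qed
      then show ?thesis by (rule factor_on_1_imp_2)
    next
      case no_triangle: False
      have disjoint_edges: False
        if "{a, b, c, d} \<subseteq> A" "distinct [a, b, c, d]" "s a b \<noteq> 0" "s c d \<noteq> 0" for a b c d
        using match[OF that] no_triangle that by auto
      obtain a where "a \<in> N" using fresh[of "{}"] by auto
      then obtain b where ab: "a \<in> A" "b \<in> A" "b \<noteq> a" "s a b \<noteq> 0" unfolding N_def by auto
      have "card {a, b} \<le> 3" by (rule card_insert_le_m1 | simp)+
      then obtain c where c: "c \<in> N" "c \<noteq> a" "c \<noteq> b" using fresh[of "{a, b}"] by auto
      have "card {a, b, c} \<le> 3" by (rule card_insert_le_m1 | simp)+
      then obtain d where d: "d \<in> N" "d \<noteq> a" "d \<noteq> b" "d \<noteq> c" using fresh[of "{a, b, c}"] by auto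
      have cd: "c \<in> A" "d \<in> A" using c d N_sub by auto
      \<comment> \<open>A neighbour of \<open>x\<close> outside \<open>a, b\<close> would give an
        edge disjoint from \<open>a b\<close>.\<close>
      have touch: "s x a \<noteq> 0 \<or> s x b \<noteq> 0" if x: "x \<in> N" "x \<noteq> a" "x \<noteq> b" for x
      proof -
        obtain y where "x \<in> A" "y \<in> A" "y \<noteq> x" "s x y \<noteq> 0" using x unfolding N_def by auto
        then show ?thesis using disjoint_edges[of a b x y] ab x by auto
      qed
      \<comment> \<open>without triangles and disjoint edges, the nonzero covariances form a star\<close>
      have star: False
        if e: "{a, b, c, d} \<subseteq> A" "distinct [a, b, c, d]" "s a b \<noteq> 0" "s a c \<noteq> 0" "s a d \<noteq> 0" for a b c d
      proof -
        have z: "s b c = 0" "s b d = 0" "s c d = 0" using no_triangle e by auto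
        obtain u v where "\<forall>i\<in>{a, b, c, d}. \<forall>j\<in>{a, b, c, d}. i \<noteq> j \<longrightarrow> s i j = u i * u j + v i * v j"
          using loc[OF e(1) card4] unfolding factor_on_2 by blast
        then have "u b * u c + v b * v c = 0" "u b * u d + v b * v d = 0" "u c * u d + v c * v d = 0"
          "u a * u b + v a * v b \<noteq> 0" "u a * u c + v a * v c \<noteq> 0" "u a * u d + v a * v d \<noteq> 0"
          using z e by auto
        then show False using orthogonal_plane_vectors by fastforce
      qed
      \<comment> \<open>If \<open>c\<close> and \<open>d\<close> touch the same end of the edge
        \<open>a b\<close>, there is a star with three leaves; if they touch different ends, there
        are two disjoint edges.\<close>
      consider "s c a \<noteq> 0" "s d a \<noteq> 0" | "s c b \<noteq> 0" "s d b \<noteq> 0"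
        | "s c a \<noteq> 0" "s d b \<noteq> 0" | "s c b \<noteq> 0" "s d a \<noteq> 0"
        using touch c d by blast
      then have False
      proof cases
        case 1 then show False using star[of a b c d] ab c d cd sym[of c a] sym[of d a] by auto
      next
        case 2 then show False using star[of b a c d] ab c d cd sym[of c b] sym[of d b] sym[of a b] by auto
      next
        case 3 then show False using disjoint_edges[of c a d b] ab c d cd by auto
      next
        case 4 then show False using disjoint_edges[of c b d a] ab c d cd by auto
      qed
      then show ?thesis ..
    qed
  qed
qed

section \<open>From local to global for two factors, and the matrix statement\<close>

theorem two_factor_finiteness:
  assumes loc: "\<And>T. T \<subseteq> A \<Longrightarrow> card T \<le> 6 \<Longrightarrow> factor_on T 2 s"
  shows "factor_on A 2 s"
proof (cases "\<exists>a b c d. {a, b, c, d} \<subseteq> A \<and> distinct [a, b, c, d] \<and> s a c * s b d - s a d * s b c \<noteq> 0")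
  case True
  then obtain a b c d where "{a, b, c, d} \<subseteq> A" "distinct [a, b, c, d]"
    "s a c * s b d - s a d * s b c \<noteq> 0" by blast
  then show ?thesis using loc by (rule factor_on_2_nonzero_tetrad)
next
  case False
  show ?thesis by (rule factor_on_2_zero_tetrads) (use False loc in auto)
qed

theorem theorem3:
  fixes p :: nat and \<Sigma> :: "real mat"
  assumes "p \<ge> 6" and "pos_def_mat p \<Sigma>"
  shows "\<Sigma> \<in> F_model p 2 - F_model p 1 \<longleftrightarrow>
    ((\<forall>S. S \<subseteq> {0..<p} \<and> card S = 6 \<longrightarrow> submatrix \<Sigma> S S \<in> F_model 6 2) \<and>
     (\<exists>S. S \<subseteq> {0..<p} \<and> card S = 4 \<and> submatrix \<Sigma> S S \<notin> F_model 4 1))"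
proof -
  let ?s = "\<lambda>i j. \<Sigma> $$ (i, j)"
  have carrier: "\<Sigma> \<in> carrier_mat p p" using assms(2) by (simp add: pos_def_mat_def)
  \<comment> \<open>One equivalence serves both \<open>m = 2, n = 6\<close> and
    \<open>m = 1, n = 4\<close>; the finiteness theorem is supplied as the premise
    \<open>glob\<close>.\<close>
  have local_iff: "factor_on {0..<p} m ?s \<longleftrightarrow>
      (\<forall>S. S \<subseteq> {0..<p} \<and> card S = n \<longrightarrow> submatrix \<Sigma> S S \<in> F_model n m)"
    if "n \<le> p" and glob: "(\<And>T. T \<subseteq> {0..<p} \<Longrightarrow> card T \<le> n \<Longrightarrow> factor_on T m ?s)
      \<Longrightarrow> factor_on {0..<p} m ?s" for m n
  proof
    assume "factor_on {0..<p} m ?s"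
    then show "\<forall>S. S \<subseteq> {0..<p} \<and> card S = n \<longrightarrow> submatrix \<Sigma> S S \<in> F_model n m"
      using submatrix_F_model_iff_factor_on[OF carrier] factor_on_subset by blast
  next
    assume "\<forall>S. S \<subseteq> {0..<p} \<and> card S = n \<longrightarrow> submatrix \<Sigma> S S \<in> F_model n m"
    then have "factor_on S m ?s" if "S \<subseteq> {0..<p}" "card S = n" for S
      using submatrix_F_model_iff_factor_on[OF carrier] that by blast
    note local = this
    show "factor_on {0..<p} m ?s"
      by (rule glob, rule factor_on_small_subset[of "{0..<p}" n m]) (use local \<open>n \<le> p\<close> in auto)
  qed
  have "factor_on {0..<p} 2 ?s \<longleftrightarrow>
      (\<forall>S. S \<subseteq> {0..<p} \<and> card S = 6 \<longrightarrow> submatrix \<Sigma> S S \<in> F_model 6 2)"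
    using assms(1) by (intro local_iff) (simp, rule two_factor_finiteness)
  moreover have "factor_on {0..<p} 1 ?s \<longleftrightarrow>
      (\<forall>S. S \<subseteq> {0..<p} \<and> card S = 4 \<longrightarrow> submatrix \<Sigma> S S \<in> F_model 4 1)"
    using assms(1) by (intro local_iff) (simp, rule one_factor_finiteness)
  \<comment> \<open>Negating the universal condition on 4-sets produces the existential
    clause.\<close>
  ultimately show ?thesis
    using F_model_iff_factor_on[OF carrier] by blast
qed

end
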